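(* Let $(X,q)$ be a quasi-metric space, let $\Phi: X\rightrightarrows X$ be a set-valued mapping, and let $\{x_n\}_{n\in\mathbb{N}}\subset X$ be a generalized Picard sequence of $\Phi$, i.e., $x_{n+1}\in\Phi(x_n)$ for all $n\in\mathbb{N}$. Assume that the following conditions hold: (E1) $\Phi(x_{n+1})\subset\Phi(x_n)$ for all $n\in\mathbb{N}$; (E2) $\lim_{n\to\infty}\sup_{x\in\Phi(x_n)} q(x_n,x)=0$; (E3) there is some $\bar{x}\in X$ such that $\bar{x}\in\Phi(x_n)$ for all $n\in\mathbb{N}$; (E4) $\{x_n\}$ has at most one forward limit. Then $$\bigcap_{n\in\mathbb{N}}\Phi(x_n)=\{\bar{x}\},$$ where $\bar{x}$ is the element from (E3). Assume, in addition, that (E5) $\Phi(\bar{x})\subset\Phi(x_n)$ for all $n\in\mathbb{N}$. Then $\bar{x}$ is a nonvariant point of $\Phi$, i.e., $\Phi(\bar{x})\subset\{\bar{x}\}$; and it is an invariant point of $\Phi$, i.e., $\Phi(\bar{x})=\{\bar{x}\}$, provided that $\Phi(\bar{x})\neq\emptyset$.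
   Context: A quasi-metric space is a pair $(X,q)$ consisting of a set $X$ and a function $q:X\times X\to\mathbb{R}_+=[0,\infty)$ such that $q(x,x)=0$ for all $x\in X$ and $q(x,z)\le q(x,y)+q(y,z)$ for all $x,y,z\in X$. Symmetry is not required, and $q(x,y)=0$ is not required to imply $x=y$. A set-valued mapping $\Phi:X\rightrightarrows X$ assigns to each $x\in X$ a (possibly empty) subset $\Phi(x)$ of $X$. A point $x_\infty\in X$ is a forward limit of a sequence $\{x_n\}$ if $\lim_{n\to\infty}q(x_n,x_\infty)=0$. *)

theory Defs
  imports "HOL-Library.Extended_Nonnegative_Real"
begin

locale quasi_metric_space =
  fixes X :: "'a set" and q :: "'a \<Rightarrow> 'a \<Rightarrow> real"
  assumes nonneg: "\<lbrakk>x \<in> X; y \<in> X\<rbrakk> \<Longrightarrow> 0 \<le> q x y"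
    and refl_zero: "x \<in> X \<Longrightarrow> q x x = 0"
    and triangle: "\<lbrakk>x \<in> X; y \<in> X; z \<in> X\<rbrakk> \<Longrightarrow> q x z \<le> q x y + q y z"

definition set_valued_mapping :: "'a set \<Rightarrow> ('a \<Rightarrow> 'a set) \<Rightarrow> bool" where
  "set_valued_mapping X \<Phi> \<longleftrightarrow> (\<forall>x\<in>X. \<Phi> x \<subseteq> X)"

definition generalized_picard_sequence ::
    "'a set \<Rightarrow> ('a \<Rightarrow> 'a set) \<Rightarrow> (nat \<Rightarrow> 'a) \<Rightarrow> bool" where
  "generalized_picard_sequence X \<Phi> x \<longleftrightarrow> (\<forall>n. x n \<in> X) \<and> (\<forall>n. x (Suc n) \<in> \<Phi> (x n))"

definition forward_limit ::
    "'a set \<Rightarrow> ('a \<Rightarrow> 'a \<Rightarrow> real) \<Rightarrow> (nat \<Rightarrow> 'a) \<Rightarrow> 'a \<Rightarrow> bool" where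
  "forward_limit X q x l \<longleftrightarrow> l \<in> X \<and> (\<lambda>n. q (x n) l) \<longlonglongrightarrow> 0"

definition nonvariant_point :: "'a set \<Rightarrow> ('a \<Rightarrow> 'a set) \<Rightarrow> 'a \<Rightarrow> bool" where
  "nonvariant_point X \<Phi> x \<longleftrightarrow> x \<in> X \<and> \<Phi> x \<subseteq> {x}"

definition invariant_point :: "'a set \<Rightarrow> ('a \<Rightarrow> 'a set) \<Rightarrow> 'a \<Rightarrow> bool" where
  "invariant_point X \<Phi> x \<longleftrightarrow> x \<in> X \<and> \<Phi> x = {x}"

text \<open>The supremum is taken in the extended nonnegative reals, so that it is \<open>\<infinity>\<close> for an
  unbounded \<open>\<Phi> x\<close>; a supremum in \<open>real\<close> would be unspecified there.\<close>

definition sup_dist :: "('a \<Rightarrow> 'a \<Rightarrow> real) \<Rightarrow> ('a \<Rightarrow> 'a set) \<Rightarrow> 'a \<Rightarrow> ennreal" where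
  "sup_dist q \<Phi> x = (SUP y\<in>\<Phi> x. ennreal (q x y))"

end

theory Submission
  imports Defs
begin

text \<open>The numbers \<open>sup_dist q \<Phi> (x n)\<close> bound the forward distances from \<open>x n\<close> to all
  points of \<open>\<Phi> (x n)\<close> at once. A point lying in every \<open>\<Phi> (x n)\<close> is therefore approached by the
  sequence at least as fast as these numbers tend to zero, so it is a forward limit
  (\<open>forward_limit_of_common_point\<close>). Uniqueness of forward limits then leaves room for only one
  common point, namely \<open>xbar\<close>. If \<open>\<Phi> xbar\<close> lies in every \<open>\<Phi> (x n)\<close>, it consists of common
  points, hence is contained in \<open>{xbar}\<close>; when nonempty, it must be all of \<open>{xbar}\<close>.\<close>

text \<open>The squeeze takes place in the extended nonnegative reals, where the supremum lives. It
  carries over to the real distances only because these are nonnegative; a negative real would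
  be collapsed to \<open>0\<close> by the embedding.\<close>

lemma forward_limit_of_common_point:
  assumes nonneg: "\<And>n. 0 \<le> q (x n) y"
    and lim: "(\<lambda>n. sup_dist q \<Phi> (x n)) \<longlonglongrightarrow> 0"
    and "y \<in> X" and common: "\<And>n. y \<in> \<Phi> (x n)"
  shows "forward_limit X q x y"
proof -
  have le: "ennreal (q (x n) y) \<le> sup_dist q \<Phi> (x n)" for n
    unfolding sup_dist_def using common by (rule SUP_upper)
  have "(\<lambda>n. ennreal (q (x n) y)) \<longlonglongrightarrow> ennreal 0"
    using tendsto_sandwich[OF _ _ tendsto_const lim, of "\<lambda>n. ennreal (q (x n) y)"]
    by (simp add: le)
  then have "(\<lambda>n. q (x n) y) \<longlonglongrightarrow> 0"
    by (subst (asm) tendsto_ennreal_iff) (simp_all add: nonneg)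
  with \<open>y \<in> X\<close> show ?thesis
    by (simp add: forward_limit_def)
qed

theorem theorem4p1:
  fixes X :: "'a set" and q :: "'a \<Rightarrow> 'a \<Rightarrow> real" and \<Phi> :: "'a \<Rightarrow> 'a set"
    and x :: "nat \<Rightarrow> 'a" and xbar :: 'a
  assumes "quasi_metric_space X q"
    and "set_valued_mapping X \<Phi>"
    and "generalized_picard_sequence X \<Phi> x"
    and E1: "\<forall>n. \<Phi> (x (Suc n)) \<subseteq> \<Phi> (x n)"
    and E2: "(\<lambda>n. sup_dist q \<Phi> (x n)) \<longlonglongrightarrow> 0"
    and E3: "xbar \<in> X" "\<forall>n. xbar \<in> \<Phi> (x n)"
    and E4: "\<forall>a b. forward_limit X q x a \<and> forward_limit X q x b \<longrightarrow> a = b"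
  shows "(\<Inter>n. \<Phi> (x n)) = {xbar} \<and>
    ((\<forall>n. \<Phi> xbar \<subseteq> \<Phi> (x n)) \<longrightarrow>
      nonvariant_point X \<Phi> xbar \<and> (\<Phi> xbar \<noteq> {} \<longrightarrow> invariant_point X \<Phi> xbar))"
proof -
  have x_in: "x n \<in> X" for n
    using assms(3) by (simp add: generalized_picard_sequence_def)
  have limit: "forward_limit X q x y" if common: "\<And>n. y \<in> \<Phi> (x n)" for y
  proof -
    have "y \<in> X"
      using common[of 0] x_in[of 0] assms(2) by (auto simp: set_valued_mapping_def)
    moreover have "0 \<le> q (x n) y" for n
      using quasi_metric_space.nonneg[OF assms(1) x_in \<open>y \<in> X\<close>] .
    ultimately show ?thesis
      using E2 common by (intro forward_limit_of_common_point)
  qed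
  have "y = xbar" if "\<And>n. y \<in> \<Phi> (x n)" for y
    using E4[rule_format, OF conjI, OF limit[OF that] limit[OF E3(2)[rule_format]]] .
  then have inter: "(\<Inter>n. \<Phi> (x n)) = {xbar}"
    using E3(2) by blast
  have "\<Phi> xbar \<subseteq> {xbar}" if "\<forall>n. \<Phi> xbar \<subseteq> \<Phi> (x n)"
    using that by (simp flip: inter add: INT_greatest)
  with inter E3(1) show ?thesis
    by (auto simp: nonvariant_point_def invariant_point_def subset_singleton_iff)
qed

end
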